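(* Let $A$ and $B$ be two finite conjunctions of linear arithmetic atoms over the rationals (equalities, weak and strict inequalities and disequalities between linear terms), and let $n = (0\ne t)$ be one of these atoms. Let $g=(0<t)$ and $l=(0>t)$. If $n\in A$, let $A^+ = (A\setminus\{n\})\cup\{g\}$, $A^-=(A\setminus\{n\})\cup\{l\}$ and $B^+=B^-=B$. If $n\in B$, let $A^+=A^-=A$, $B^+=(B\setminus\{n\})\cup\{g\}$ and $B^- = (B\setminus\{n\})\cup\{l\}$. Assume that $A^+\wedge B^+$ and $A^-\wedge B^-$ are both unsatisfiable over $\mathbb Q$, and let $I^+$ and $I^-$ be interpolants for $(A^+,B^+)$ and $(A^-,B^-)$ respectively. Let $I = I^+\vee I^-$ if $n\in A$, and $I = I^+\wedge I^-$ if $n\in B$. Then $I$ is an interpolant for $(A,B)$.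
   Context: An interpolant for a pair $(X,Y)$ of formulas with $X\wedge Y$ unsatisfiable over $\mathbb Q$ is a formula $I$ such that $X\models I$, $I\wedge Y$ is unsatisfiable, and every variable occurring in $I$ occurs both in $X$ and in $Y$. *)

theory Defs
  imports Complex_Main "HOL-Library.FSet"
begin

datatype (term_vars: 'v) lin_term =
    Const rat
  | Var 'v
  | Add "'v lin_term" "'v lin_term"
  | Scale rat "'v lin_term"

primrec term_val :: "('v \<Rightarrow> rat) \<Rightarrow> 'v lin_term \<Rightarrow> rat" where
  "term_val v (Const c) = c"
| "term_val v (Var x) = v x"
| "term_val v (Add s t) = term_val v s + term_val v t"
| "term_val v (Scale c t) = c * term_val v t"

datatype (atom_vars: 'v) atom =
    EQ "'v lin_term" "'v lin_term"
  | NE "'v lin_term" "'v lin_term"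
  | LE "'v lin_term" "'v lin_term"
  | LT "'v lin_term" "'v lin_term"
  | GE "'v lin_term" "'v lin_term"
  | GT "'v lin_term" "'v lin_term"

primrec atom_holds :: "('v \<Rightarrow> rat) \<Rightarrow> 'v atom \<Rightarrow> bool" where
  "atom_holds v (EQ s t) \<longleftrightarrow> term_val v s = term_val v t"
| "atom_holds v (NE s t) \<longleftrightarrow> term_val v s \<noteq> term_val v t"
| "atom_holds v (LE s t) \<longleftrightarrow> term_val v s \<le> term_val v t"
| "atom_holds v (LT s t) \<longleftrightarrow> term_val v s < term_val v t"
| "atom_holds v (GE s t) \<longleftrightarrow> term_val v s \<ge> term_val v t"
| "atom_holds v (GT s t) \<longleftrightarrow> term_val v s > term_val v t"

text \<open>Formulas are quantifier-free. \<open>form_vars\<close>, generated by the datatype declaration,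
  is the set of syntactically occurring variables (so \<open>x\<close> occurs in \<open>Scale 0 (Var x)\<close>).
  \<open>BigAnd\<close> is the conjunction of a finite set of formulas; \<open>BigAnd {||}\<close> is truth.\<close>

datatype (form_vars: 'v) form =
    Atom "'v atom"
  | Neg "'v form"
  | And "'v form" "'v form"
  | Or "'v form" "'v form"
  | BigAnd "'v form fset"

primrec holds :: "('v \<Rightarrow> rat) \<Rightarrow> 'v form \<Rightarrow> bool" where
  "holds v (Atom a) \<longleftrightarrow> atom_holds v a"
| "holds v (Neg F) \<longleftrightarrow> \<not> holds v F"
| "holds v (And F G) \<longleftrightarrow> holds v F \<and> holds v G"
| "holds v (Or F G) \<longleftrightarrow> holds v F \<or> holds v G"
| "holds v (BigAnd Fs) \<longleftrightarrow> fBall (holds v |`| Fs) (\<lambda>b. b)"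

definition unsat :: "'v form \<Rightarrow> bool" where
  "unsat F \<longleftrightarrow> \<not> (\<exists>v. holds v F)"

definition entails :: "'v form \<Rightarrow> 'v form \<Rightarrow> bool" where
  "entails F G \<longleftrightarrow> (\<forall>v. holds v F \<longrightarrow> holds v G)"

definition interpolant :: "'v form \<Rightarrow> 'v form \<Rightarrow> 'v form \<Rightarrow> bool" where
  "interpolant X Y I \<longleftrightarrow>
     unsat (And X Y) \<and> entails X I \<and> unsat (And I Y) \<and>
     form_vars I \<subseteq> form_vars X \<inter> form_vars Y"

definition conj_of :: "'v atom fset \<Rightarrow> 'v form" where
  "conj_of A = BigAnd (Atom |`| A)"

end

theory Submission
  imports Defs
begin

text \<open>Over the ordered field of rationals, \<open>0 \<noteq> t\<close> means
  \<open>0 < t\<close> or \<open>0 > t\<close>. Hence the conjunction containing \<open>n\<close>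
  has exactly the models of its two strengthened versions together
  (\<open>holds_conj_of_split\<close>), and since all three atoms mention the variables of
  \<open>t\<close> only, the set of occurring variables does not change
  (\<open>form_vars_conj_of_replace\<close>). It remains to combine interpolants along a case split:
  a split of the first formula calls for a disjunction (\<open>interpolant_Or\<close>), a split of
  the second for a conjunction (\<open>interpolant_And\<close>).\<close>

lemma holds_conj_of: "holds v (conj_of A) \<longleftrightarrow> (\<forall>a. a |\<in>| A \<longrightarrow> atom_holds v a)"
  by (auto simp: conj_of_def)

lemma form_vars_conj_of: "form_vars (conj_of A) = (\<Union>a\<in>fset A. atom_vars a)"
  by (auto simp: conj_of_def)

lemma holds_conj_of_split:
  assumes "NE (Const 0) t |\<in>| A"
  shows "holds v (conj_of A) \<longleftrightarrow>
    holds v (conj_of ((A |-| {|NE (Const 0) t|}) |\<union>| {|LT (Const 0) t|})) \<or>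
    holds v (conj_of ((A |-| {|NE (Const 0) t|}) |\<union>| {|GT (Const 0) t|}))"
proof -
  \<comment> \<open>All three conjunctions share the atoms of \<open>A\<close> other than the
    disequality. Isolating this common part leaves a comparison of single atoms, settled by
    trichotomy.\<close>
  have "holds v (conj_of ((A |-| {|NE (Const 0) t|}) |\<union>| {|b|})) \<longleftrightarrow>
      (\<forall>a. a |\<in>| A \<longrightarrow> a \<noteq> NE (Const 0) t \<longrightarrow> atom_holds v a) \<and> atom_holds v b" for b
    by (auto simp: holds_conj_of)
  moreover have "holds v (conj_of A) \<longleftrightarrow>
      (\<forall>a. a |\<in>| A \<longrightarrow> a \<noteq> NE (Const 0) t \<longrightarrow> atom_holds v a) \<and> atom_holds v (NE (Const 0) t)"
    using assms by (auto simp: holds_conj_of)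
  moreover have "atom_holds v (NE (Const 0) t) \<longleftrightarrow>
      atom_holds v (LT (Const 0) t) \<or> atom_holds v (GT (Const 0) t)"
    by auto
  ultimately show ?thesis by blast
qed

text \<open>Variables that disappear with \<open>n\<close> come back with \<open>b\<close>. This
  keeps the variable condition on interpolants, which is syntactic, intact.\<close>

lemma form_vars_conj_of_replace:
  assumes "n |\<in>| A" and "atom_vars b = atom_vars n"
  shows "form_vars (conj_of ((A |-| {|n|}) |\<union>| {|b|})) = form_vars (conj_of A)"
  using assms by (auto simp: form_vars_conj_of)

text \<open>Each model of \<open>X\<close> lies in one of the two cases and so satisfies the
  matching disjunct, while each disjunct separately contradicts the common \<open>Y\<close>.\<close>

lemma interpolant_Or:
  assumes "interpolant X\<^sub>1 Y I\<^sub>1" and "interpolant X\<^sub>2 Y I\<^sub>2"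
    and "\<And>v. holds v X \<longleftrightarrow> holds v X\<^sub>1 \<or> holds v X\<^sub>2"
    and "form_vars X\<^sub>1 = form_vars X" and "form_vars X\<^sub>2 = form_vars X"
  shows "interpolant X Y (Or I\<^sub>1 I\<^sub>2)"
  using assms by (auto simp: interpolant_def unsat_def entails_def)

text \<open>Dually, \<open>X\<close> entails both conjuncts, and a model of \<open>Y\<close> falls
  into one of the cases, where the matching conjunct is violated.\<close>

lemma interpolant_And:
  assumes "interpolant X Y\<^sub>1 I\<^sub>1" and "interpolant X Y\<^sub>2 I\<^sub>2"
    and "\<And>v. holds v Y \<longleftrightarrow> holds v Y\<^sub>1 \<or> holds v Y\<^sub>2"
    and "form_vars Y\<^sub>1 = form_vars Y" and "form_vars Y\<^sub>2 = form_vars Y"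
  shows "interpolant X Y (And I\<^sub>1 I\<^sub>2)"
  using assms by (auto simp: interpolant_def unsat_def entails_def)

theorem mainTheorem4:
  fixes A B A\<^sub>p A\<^sub>m B\<^sub>p B\<^sub>m :: "'v atom fset"
    and n g l :: "'v atom" and t :: "'v lin_term"
    and I\<^sub>p I\<^sub>m I :: "'v form"
  assumes "n = NE (Const 0) t"
    and "g = LT (Const 0) t"
    and "l = GT (Const 0) t"
    and "n |\<in>| A \<and>
           A\<^sub>p = (A |-| {|n|}) |\<union>| {|g|} \<and> A\<^sub>m = (A |-| {|n|}) |\<union>| {|l|} \<and>
           B\<^sub>p = B \<and> B\<^sub>m = B \<and>
           I = Or I\<^sub>p I\<^sub>m
         \<or> n |\<in>| B \<and>
           A\<^sub>p = A \<and> A\<^sub>m = A \<and>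
           B\<^sub>p = (B |-| {|n|}) |\<union>| {|g|} \<and> B\<^sub>m = (B |-| {|n|}) |\<union>| {|l|} \<and>
           I = And I\<^sub>p I\<^sub>m"
    and "unsat (And (conj_of A\<^sub>p) (conj_of B\<^sub>p))"
    and "unsat (And (conj_of A\<^sub>m) (conj_of B\<^sub>m))"
    and "interpolant (conj_of A\<^sub>p) (conj_of B\<^sub>p) I\<^sub>p"
    and "interpolant (conj_of A\<^sub>m) (conj_of B\<^sub>m) I\<^sub>m"
  shows "interpolant (conj_of A) (conj_of B) I"
proof -
  have vars: "atom_vars g = atom_vars n" "atom_vars l = atom_vars n"
    using assms(1-3) by simp_all
  \<comment> \<open>If \<open>n\<close> occurs in both \<open>A\<close> and \<open>B\<close>, either
    case may apply: only the chosen side is split, and the other keeps \<open>n\<close>.\<close>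
  from assms(4) show ?thesis
  proof (elim disjE conjE)
    assume n: "n |\<in>| A" and eqs: "A\<^sub>p = (A |-| {|n|}) |\<union>| {|g|}" "A\<^sub>m = (A |-| {|n|}) |\<union>| {|l|}"
      "B\<^sub>p = B" "B\<^sub>m = B" "I = Or I\<^sub>p I\<^sub>m"
    have "holds v (conj_of A) \<longleftrightarrow> holds v (conj_of A\<^sub>p) \<or> holds v (conj_of A\<^sub>m)" for v
      using holds_conj_of_split[OF n[unfolded assms(1)]] unfolding eqs assms(1-3) .
    moreover have "form_vars (conj_of A\<^sub>p) = form_vars (conj_of A)"
      "form_vars (conj_of A\<^sub>m) = form_vars (conj_of A)"
      unfolding eqs by (rule form_vars_conj_of_replace[OF n vars(1)], rule form_vars_conj_of_replace[OF n vars(2)])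
    \<comment> \<open>Rewriting \<open>B\<^sub>p\<close> and \<open>B\<^sub>m\<close> to
      \<open>B\<close> gives both interpolants the same second formula, as
      \<open>interpolant_Or\<close> demands; \<open>A\<^sub>p\<close> and \<open>A\<^sub>m\<close>
      stay folded to match the facts just proved.\<close>
    ultimately show ?thesis
      using interpolant_Or[OF assms(7,8)[unfolded eqs(3,4)]] unfolding eqs(3-5) by blast
  next
    assume n: "n |\<in>| B" and eqs: "A\<^sub>p = A" "A\<^sub>m = A"
      "B\<^sub>p = (B |-| {|n|}) |\<union>| {|g|}" "B\<^sub>m = (B |-| {|n|}) |\<union>| {|l|}" "I = And I\<^sub>p I\<^sub>m"
    have "holds v (conj_of B) \<longleftrightarrow> holds v (conj_of B\<^sub>p) \<or> holds v (conj_of B\<^sub>m)" for v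
      using holds_conj_of_split[OF n[unfolded assms(1)]] unfolding eqs assms(1-3) .
    moreover have "form_vars (conj_of B\<^sub>p) = form_vars (conj_of B)"
      "form_vars (conj_of B\<^sub>m) = form_vars (conj_of B)"
      unfolding eqs by (rule form_vars_conj_of_replace[OF n vars(1)], rule form_vars_conj_of_replace[OF n vars(2)])
    ultimately show ?thesis
      using interpolant_And[OF assms(7,8)[unfolded eqs(1,2)]] unfolding eqs(1,2,5) by blast
  qed
qed

end
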